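(* Let $(X,d,\mu)$ be an $s$-Ahlfors-regular quasi-metric measure space. Then $B^{0,v}_1(X)=L^1(X)$ for all $v>-1$. More precisely, for any $f\in B^{0,v}_1(X)$, $$\|f\|_{L^1(X)}\le\|f\|_{B^{0,v}_1(X)}\le\|f\|_{L^1(X)}\Bigl(1+\frac1{1+v}\Bigl(\log^+\frac1{\mu(X)}\Bigr)^{1+v}\Bigr).$$
   Context: An $s$-Ahlfors-regular quasi-metric measure space $(X,d,\mu)$ is a set $X$ with a function $d:X\times X\to[0,\infty)$ such that $d(x,y)=d(y,x)$; $d(x,y)=0$ iff $x=y$; and for some constant $A\ge 1$, $d(x,y)\le A(d(x,z)+d(z,y))$ for all $x,y,z\in X$; together with a nonzero Borel regular measure $\mu$ on $X$ for which there are constants $c,C,s>0$ with $$c\,r^s\le\mu(B(x,r))\le C\,r^s,\qquad x\in X,\ 0<r<\operatorname{diam}(X),$$ where $B(x,r)=\{y\in X:d(x,y)<r\}$ (a ball) and $\operatorname{diam}(X)=\sup\{d(x,y):x,y\in X\}\in[0,\infty]$. Balls are understood to be $\mu$-measurable. Write $\log^+t=\max\{\log t,0\}$, with $\log^+(1/\mu(X))=0$ if $\mu(X)=\infty$. For $v>-1$, $t>0$ set $\phi_{0,v}(t)=\chi_{(0,1)}(t)\int_t^1 s^{-1}(\log^+(1/s))^v\,ds=\frac1{1+v}(\log^+(1/t))^{1+v}$. $1$-block (the case $q=1$ of the $q$-block condition $\|a\|_{L^q(B)}\le\mu(B)^{-1/q'}$, with $1'=\infty$): a measurable function $a$ on $X$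 for which there is a ball $B\subset X$ with $0<\mu(B)<\infty$, $\operatorname{supp}a\subseteq B$ (i.e. $a$ vanishes outside $B$), and $\|a\|_{L^1(B)}\le1$. $B^{0,v}_1(X)$ consists of all $f\in L^1(X)$ admitting a decomposition $f=\sum_{j=1}^\infty\lambda_ja_j$ with $\lambda_j\in\mathbb C$, each $a_j$ a $1$-block supported on a ball $B_j$, and $\sum_{j=1}^\infty|\lambda_j|(1+\phi_{0,v}(\mu(B_j)))<\infty$. Its norm $\|f\|_{B^{0,v}_1(X)}$ is the infimum of $\sum_{j=1}^\infty|\lambda_j|(1+\phi_{0,v}(\mu(B_j)))$ over all such decompositions.
   Formalization: Every ball is additionally assumed to have finite measure (i.e. a bounded X has μ(X)<∞); without this the upper bound fails, e.g. for infinitely many copies of [0,1/2] at mutual distance 1. *)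

theory Defs
  imports "HOL-Analysis.Analysis"
begin

subsection \<open>Ahlfors-regular quasi-metric measure spaces\<close>

definition quasi_metric_on :: "'a set \<Rightarrow> ('a \<Rightarrow> 'a \<Rightarrow> real) \<Rightarrow> bool" where
  "quasi_metric_on X d \<longleftrightarrow>
     (\<forall>x\<in>X. \<forall>y\<in>X. 0 \<le> d x y \<and> d x y = d y x \<and> (d x y = 0 \<longleftrightarrow> x = y)) \<and>
     (\<exists>A\<ge>1. \<forall>x\<in>X. \<forall>y\<in>X. \<forall>z\<in>X. d x y \<le> A * (d x z + d z y))"

definition qball :: "'a set \<Rightarrow> ('a \<Rightarrow> 'a \<Rightarrow> real) \<Rightarrow> 'a \<Rightarrow> real \<Rightarrow> 'a set" where
  "qball X d x r = {y \<in> X. d x y < r}"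

definition qdiam :: "'a set \<Rightarrow> ('a \<Rightarrow> 'a \<Rightarrow> real) \<Rightarrow> ennreal" where
  "qdiam X d = (SUP p\<in>X \<times> X. ennreal (d (fst p) (snd p)))"

text \<open>The topology induced by a quasi-metric. Balls need not be open, nor even Borel,
  for this topology.\<close>

definition qopen :: "'a set \<Rightarrow> ('a \<Rightarrow> 'a \<Rightarrow> real) \<Rightarrow> 'a set \<Rightarrow> bool" where
  "qopen X d U \<longleftrightarrow> U \<subseteq> X \<and> (\<forall>x\<in>U. \<exists>r>0. qball X d x r \<subseteq> U)"

definition qborel_sets :: "'a set \<Rightarrow> ('a \<Rightarrow> 'a \<Rightarrow> real) \<Rightarrow> 'a set set" where
  "qborel_sets X d = sigma_sets X {U. qopen X d U}"

text \<open>The \<open>\<sigma>\<close>-algebra of the measure may be larger than the Borel one (for instance the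
  Caratheodory-measurable sets of a Borel regular outer measure).\<close>

definition borel_regular :: "'a measure \<Rightarrow> ('a \<Rightarrow> 'a \<Rightarrow> real) \<Rightarrow> bool" where
  "borel_regular M d \<longleftrightarrow>
     qborel_sets (space M) d \<subseteq> sets M \<and>
     (\<forall>E\<in>sets M. \<exists>F\<in>qborel_sets (space M) d. E \<subseteq> F \<and> emeasure M F = emeasure M E)"

definition ahlfors_regular :: "real \<Rightarrow> 'a measure \<Rightarrow> ('a \<Rightarrow> 'a \<Rightarrow> real) \<Rightarrow> bool" where
  "ahlfors_regular s M d \<longleftrightarrow>
     quasi_metric_on (space M) d \<and>
     borel_regular M d \<and>
     emeasure M (space M) \<noteq> 0 \<and>
     (\<forall>x\<in>space M. \<forall>r>0. qball (space M) d x r \<in> sets M) \<and>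
     s > 0 \<and>
     (\<exists>c>0. \<exists>C>0. \<forall>x\<in>space M. \<forall>r>0. ennreal r < qdiam (space M) d \<longrightarrow>
        ennreal (c * r powr s) \<le> emeasure M (qball (space M) d x r) \<and>
        emeasure M (qball (space M) d x r) \<le> ennreal (C * r powr s))"

subsection \<open>Block spaces\<close>

definition log_plus :: "real \<Rightarrow> real" where
  "log_plus t = max (ln t) 0"

definition log_plus_inv :: "ennreal \<Rightarrow> real" where
  "log_plus_inv m = (if m = \<infinity> then 0 else log_plus (1 / enn2real m))"

definition phi0 :: "real \<Rightarrow> real \<Rightarrow> real" where
  "phi0 v t = indicator {0<..<1} t * integral {t..1} (\<lambda>s. (1 / s) * log_plus (1 / s) powr v)"

definition is_qball :: "'a measure \<Rightarrow> ('a \<Rightarrow> 'a \<Rightarrow> real) \<Rightarrow> 'a set \<Rightarrow> bool" where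
  "is_qball M d B \<longleftrightarrow> (\<exists>x\<in>space M. \<exists>r>0. B = qball (space M) d x r)"

definition one_block ::
  "'a measure \<Rightarrow> ('a \<Rightarrow> 'a \<Rightarrow> real) \<Rightarrow> 'a set \<Rightarrow> ('a \<Rightarrow> complex) \<Rightarrow> bool" where
  "one_block M d B a \<longleftrightarrow>
     is_qball M d B \<and> 0 < emeasure M B \<and> emeasure M B < \<infinity> \<and>
     a \<in> borel_measurable M \<and>
     (\<forall>x\<in>space M - B. a x = 0) \<and>
     (\<integral>\<^sup>+ x\<in>B. ennreal (norm (a x)) \<partial>M) \<le> 1"

text \<open>The series is required to converge to \<open>f\<close> almost everywhere. As the coefficients are
  absolutely summable and the blocks have \<open>L\<^sup>1\<close> norm at most 1, the series converges
  absolutely almost everywhere and in \<open>L\<^sup>1\<close>, to the same limit.\<close>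

definition block_decomp ::
  "real \<Rightarrow> 'a measure \<Rightarrow> ('a \<Rightarrow> 'a \<Rightarrow> real) \<Rightarrow> ('a \<Rightarrow> complex) \<Rightarrow>
   (nat \<Rightarrow> complex) \<Rightarrow> (nat \<Rightarrow> 'a \<Rightarrow> complex) \<Rightarrow> (nat \<Rightarrow> 'a set) \<Rightarrow> bool" where
  "block_decomp v M d f l a B \<longleftrightarrow>
     (\<forall>j. one_block M d (B j) (a j)) \<and>
     summable (\<lambda>j. norm (l j) * (1 + phi0 v (measure M (B j)))) \<and>
     (AE x in M. (\<lambda>j. l j * a j x) sums f x)"

definition block_space :: "real \<Rightarrow> 'a measure \<Rightarrow> ('a \<Rightarrow> 'a \<Rightarrow> real) \<Rightarrow> ('a \<Rightarrow> complex) set" where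
  "block_space v M d = {f. integrable M f \<and> (\<exists>l a B. block_decomp v M d f l a B)}"

definition block_norm :: "real \<Rightarrow> 'a measure \<Rightarrow> ('a \<Rightarrow> 'a \<Rightarrow> real) \<Rightarrow> ('a \<Rightarrow> complex) \<Rightarrow> real" where
  "block_norm v M d f =
     Inf {(\<Sum>j. norm (l j) * (1 + phi0 v (measure M (B j)))) | l a B. block_decomp v M d f l a B}"

end

theory Submission imports Defs begin

text \<open>Since \<open>q = 1\<close>, the block condition does not see the size of the ball, so large balls are
  cheapest. Cut \<open>f\<close> along an increasing sequence of concentric balls exhausting \<open>X\<close> and starting
  with a ball \<open>B\<close>: this decomposes \<open>f\<close> at a cost of at most \<open>\<parallel>f\<parallel>\<^sub>1 (1 + \<phi>(\<mu>(B)))\<close>.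
  Letting \<open>B\<close> grow to \<open>X\<close> gives the upper bound, by continuity of \<open>\<phi>\<close> if \<open>\<mu>(X) < \<infinity>\<close>, and because
  \<open>\<phi>\<close> vanishes on \<open>[1, \<infinity>)\<close> otherwise.\<close>

section \<open>The weight \<open>phi0\<close>: closed form, monotonicity and limits\<close>

lemma phi0_eq:
  assumes "v > -1" "t > 0"
  shows "phi0 v t = 1 / (1 + v) * log_plus (1 / t) powr (1 + v)"
proof (cases "t < 1")
  case False
  then have "ln (1 / t) \<le> 0" using \<open>t > 0\<close> by simp
  with False show ?thesis by (simp add: phi0_def log_plus_def max_def)
next
  case True
  define F where "F = (\<lambda>x. - (1 / (1 + v)) * ln (1 / x) powr (1 + v))"
  \<comment> \<open>At x = 1 the base ln (1 / x) reaches 0. The exponent 1 + v > 0 still gives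
    continuity of \<open>F\<close> there, but for v < 0 no finite derivative. Hence the fundamental
    theorem is used in the form that asks for derivatives only in the interior.\<close>
  have cont: "continuous_on {t..1} F"
    unfolding F_def using assms by (intro continuous_intros continuous_on_powr') auto
  have deriv: "(F has_vector_derivative 1 / x * log_plus (1 / x) powr v) (at x)"
    if x: "x \<in> {t<..<1}" for x
  proof -
    have pos: "x > 0" "ln (1 / x) > 0" using x \<open>t > 0\<close> by auto
    have "((\<lambda>x. ln (1 / x)) has_real_derivative - (1 / x)) (at x)"
      using pos by (auto intro!: derivative_eq_intros simp: field_simps power2_eq_square)
    from DERIV_cmult[OF DERIV_fun_powr[OF this pos(2), of "1 + v"], of "- (1 / (1 + v))"]
    have "(F has_real_derivative 1 / x * ln (1 / x) powr v) (at x)"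
      using \<open>v > -1\<close> by (simp add: F_def)
    then show ?thesis
      using pos by (simp add: log_plus_def has_real_derivative_iff_has_vector_derivative)
  qed
  have "((\<lambda>x. 1 / x * log_plus (1 / x) powr v) has_integral (F 1 - F t)) {t..1}"
    using True by (intro fundamental_theorem_of_calculus_interior cont deriv) auto
  then have "integral {t..1} (\<lambda>x. 1 / x * log_plus (1 / x) powr v) = F 1 - F t"
    by (rule integral_unique)
  moreover have "log_plus (1 / t) = ln (1 / t)"
    using True \<open>t > 0\<close> by (simp add: log_plus_def)
  ultimately show ?thesis
    using True \<open>t > 0\<close> by (simp add: phi0_def F_def)
qed

lemma phi0_nonneg:
  assumes "v > -1"
  shows "phi0 v t \<ge> 0"
proof (cases "t > 0")
  case True
  then show ?thesis using assms by (simp add: phi0_eq)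
qed (simp add: phi0_def)

lemma phi0_antimono:
  assumes "v > -1" "0 < t" "t \<le> u"
  shows "phi0 v u \<le> phi0 v t"
proof -
  have "log_plus (1 / u) \<le> log_plus (1 / t)" "0 \<le> log_plus (1 / u)"
    using assms unfolding log_plus_def by (intro max.mono) (auto simp: ln_div)
  then have "log_plus (1 / u) powr (1 + v) \<le> log_plus (1 / t) powr (1 + v)"
    using assms by (intro powr_mono2) auto
  with assms show ?thesis by (simp add: phi0_eq divide_right_mono)
qed

lemma tendsto_phi0:
  assumes "v > -1" "t > 0" "(g \<longlongrightarrow> t) F"
  shows "((\<lambda>n. phi0 v (g n)) \<longlongrightarrow> phi0 v t) F"
proof -
  \<comment> \<open>For t >= 1 the base tends to 0. The power still passes to the limit, because the
    bases are nonnegative and 1 + v is positive.\<close>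
  have "((\<lambda>n. 1 / (1 + v) * max (ln (1 / g n)) 0 powr (1 + v))
      \<longlongrightarrow> 1 / (1 + v) * max (ln (1 / t)) 0 powr (1 + v)) F"
    using assms by (intro tendsto_intros tendsto_powr') auto
  moreover have "\<forall>\<^sub>F n in F. 1 / (1 + v) * max (ln (1 / g n)) 0 powr (1 + v) = phi0 v (g n)"
    using order_tendstoD(1)[OF assms(3,2)]
    by eventually_elim (use assms in \<open>simp add: phi0_eq log_plus_def\<close>)
  ultimately show ?thesis
    using assms by (simp add: phi0_eq log_plus_def tendsto_cong)
qed

text \<open>This limit is the constant of the norm estimate. By continuity from below the measures
  of the sets \<open>U n\<close> tend to that of the space. If the latter is infinite,
  \<open>phi0\<close> is eventually 0, in agreement with the convention in
  \<open>log_plus_inv\<close>; otherwise \<open>phi0\<close> is continuous at the positive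
  limit.\<close>

lemma phi0_measure_space_tendsto:
  assumes "v > -1" "emeasure M (space M) \<noteq> 0"
    and "range U \<subseteq> sets M" "incseq U" "(\<Union>n. U n) = space M" "\<And>n. emeasure M (U n) < \<infinity>"
  shows "(\<lambda>n. phi0 v (measure M (U n)))
    \<longlonglongrightarrow> 1 / (1 + v) * log_plus_inv (emeasure M (space M)) powr (1 + v)"
proof -
  have lim: "(\<lambda>n. emeasure M (U n)) \<longlonglongrightarrow> emeasure M (space M)"
    using Lim_emeasure_incseq[of U M] assms by auto
  show ?thesis
  proof (cases "emeasure M (space M) = \<infinity>")
    case True
    have "\<forall>\<^sub>F n in sequentially. 1 < emeasure M (U n)"
      using order_tendstoD(1)[OF lim, of 1] True by simp
    then have "\<forall>\<^sub>F n in sequentially. phi0 v (measure M (U n)) = 0"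
    proof eventually_elim
      case (elim n)
      \<comment> \<open>Finiteness of \<open>U n\<close> matters here: \<open>measure\<close> sends
        an infinite value to 0.\<close>
      have "ennreal 1 < ennreal (measure M (U n))"
        using elim assms(6)[of n] by (simp add: emeasure_eq_ennreal_measure)
      then have "\<not> measure M (U n) < 1" by (simp add: ennreal_less_iff)
      then show ?case by (simp add: phi0_def)
    qed
    then show ?thesis
      using True by (simp add: log_plus_inv_def tendsto_eventually)
  next
    case False
    then have "(\<lambda>n. measure M (U n)) \<longlonglongrightarrow> measure M (space M)"
      unfolding measure_def using lim by (intro tendsto_enn2real) (auto simp: top.not_eq_extremum)
    moreover have "measure M (space M) > 0"
      using assms(2) False
      by (auto simp: measure_def enn2real_positive_iff top.not_eq_extremum zero_less_iff_neq_zero)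
    ultimately have "(\<lambda>n. phi0 v (measure M (U n))) \<longlonglongrightarrow> phi0 v (measure M (space M))"
      using assms(1) by (intro tendsto_phi0)
    with False \<open>measure M (space M) > 0\<close> show ?thesis
      using assms(1) by (simp add: phi0_eq log_plus_inv_def measure_def)
  qed
qed

section \<open>The lower bound for the cost of a decomposition\<close>

lemma nn_integral_one_block_le:
  assumes "one_block M d B a"
  shows "(\<integral>\<^sup>+ x. ennreal (norm (a x)) \<partial>M) \<le> 1"
proof -
  have "(\<integral>\<^sup>+ x. ennreal (norm (a x)) \<partial>M) = (\<integral>\<^sup>+ x\<in>B. ennreal (norm (a x)) \<partial>M)"
    using assms by (intro nn_integral_cong) (auto simp: one_block_def indicator_def)
  with assms show ?thesis by (simp add: one_block_def)
qed

text \<open>The triangle inequality passes from partial sums to the limit. With the right side in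
  \<open>ennreal\<close>, a divergent series makes the bound trivial, so absolute convergence need
  not be shown first.\<close>

lemma ennreal_norm_sums_le:
  fixes f :: "nat \<Rightarrow> 'b::real_normed_vector"
  assumes "f sums y"
  shows "ennreal (norm y) \<le> (\<Sum>j. ennreal (norm (f j)))"
proof (rule LIMSEQ_le_const2)
  show "(\<lambda>n. ennreal (norm (\<Sum>j<n. f j))) \<longlonglongrightarrow> ennreal (norm y)"
    using assms by (auto simp: sums_def intro!: tendsto_intros)
  have "ennreal (norm (\<Sum>j<n. f j)) \<le> (\<Sum>j. ennreal (norm (f j)))" for n
  proof -
    have "ennreal (norm (\<Sum>j<n. f j)) \<le> (\<Sum>j<n. ennreal (norm (f j)))"
      by (simp add: norm_sum sum_ennreal ennreal_leI)
    also have "\<dots> \<le> (\<Sum>j. ennreal (norm (f j)))"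
      by (intro sum_le_suminf) auto
    finally show ?thesis .
  qed
  then show "\<exists>N. \<forall>n\<ge>N. ennreal (norm (\<Sum>j<n. f j)) \<le> (\<Sum>j. ennreal (norm (f j)))"
    by blast
qed

text \<open>Triangle inequality under the integral, then exchange of sum and integral for
  nonnegative terms: the j-th term contributes at most the modulus of \<open>l j\<close>, and its
  weight in the cost is at least 1 since \<open>phi0\<close> is nonnegative.\<close>

lemma integral_norm_le_block_sum:
  assumes v: "v > -1" and f: "integrable M f" and dec: "block_decomp v M d f l a B"
  shows "(\<integral>x. norm (f x) \<partial>M) \<le> (\<Sum>j. norm (l j) * (1 + phi0 v (measure M (B j))))"
proof -
  define w where "w j = norm (l j) * (1 + phi0 v (measure M (B j)))" for j
  have blk: "one_block M d (B j) (a j)" for j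
    using dec by (simp add: block_decomp_def)
  have sw: "summable w" and ae: "AE x in M. (\<lambda>j. l j * a j x) sums f x"
    using dec by (auto simp: block_decomp_def w_def[abs_def])
  have [measurable]: "a j \<in> borel_measurable M" for j
    using blk by (simp add: one_block_def)
  have lw: "norm (l j) \<le> w j" for j
    using phi0_nonneg[OF v, of "measure M (B j)"] by (simp add: w_def distrib_left)
  have w0: "0 \<le> w j" for j
    using lw[of j] by (meson norm_ge_zero order_trans)
  have "(\<integral>\<^sup>+ x. ennreal (norm (f x)) \<partial>M) \<le> (\<integral>\<^sup>+ x. (\<Sum>j. ennreal (norm (l j * a j x))) \<partial>M)"
    using ae by (intro nn_integral_mono_AE) (auto elim!: eventually_mono intro: ennreal_norm_sums_le)
  also have "\<dots> = (\<Sum>j. \<integral>\<^sup>+ x. ennreal (norm (l j * a j x)) \<partial>M)"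
    by (intro nn_integral_suminf) measurable
  also have "\<dots> \<le> (\<Sum>j. ennreal (w j))"
  proof (intro suminf_le)
    fix j
    have "(\<integral>\<^sup>+ x. ennreal (norm (l j * a j x)) \<partial>M)
        = ennreal (norm (l j)) * (\<integral>\<^sup>+ x. ennreal (norm (a j x)) \<partial>M)"
      by (simp add: norm_mult ennreal_mult nn_integral_cmult)
    also have "\<dots> \<le> ennreal (w j) * 1"
      using lw by (intro mult_mono nn_integral_one_block_le[OF blk] ennreal_leI) auto
    finally show "(\<integral>\<^sup>+ x. ennreal (norm (l j * a j x)) \<partial>M) \<le> ennreal (w j)" by simp
  qed auto
  also have "\<dots> = ennreal (\<Sum>j. w j)"
    using w0 sw by (intro suminf_ennreal2)
  finally have "ennreal (\<integral>x. norm (f x) \<partial>M) \<le> ennreal (\<Sum>j. w j)"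
    using f by (simp add: nn_integral_eq_integral)
  then show ?thesis
    using suminf_nonneg[OF sw w0] by (simp add: w_def)
qed

section \<open>Cutting a function along an increasing sequence of balls\<close>

lemma partition_integral_norm_sums:
  fixes f :: "'a \<Rightarrow> 'b::{banach, second_countable_topology}"
  assumes f: "integrable M f" and D: "\<And>k. D k \<in> sets M" "disjoint_family D" "(\<Union>k. D k) = space M"
  shows "(\<lambda>k. \<integral>x. norm (f x) * indicator (D k) x \<partial>M) sums (\<integral>x. norm (f x) \<partial>M)"
proof -
  have [measurable]: "f \<in> borel_measurable M" using f by simp
  \<comment> \<open>In \<open>ennreal\<close>, countable additivity needs no proof of summability;
    since the terms are nonnegative, \<open>sums_ennreal\<close> carries the result back to the
    reals at the end.\<close>
  have "(\<Sum>k. ennreal (\<integral>x. norm (f x) * indicator (D k) x \<partial>M))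
      = (\<Sum>k. \<integral>\<^sup>+ x\<in>D k. ennreal (norm (f x)) \<partial>M)"
  proof (intro suminf_cong)
    fix k
    have "ennreal (\<integral>x. norm (f x) * indicator (D k) x \<partial>M)
        = (\<integral>\<^sup>+ x. ennreal (norm (f x) * indicator (D k) x) \<partial>M)"
      using f D(1)
      by (intro nn_integral_eq_integral[symmetric] integrable_real_mult_indicator) auto
    also have "\<dots> = (\<integral>\<^sup>+ x\<in>D k. ennreal (norm (f x)) \<partial>M)"
      by (intro nn_integral_cong) (simp add: indicator_def)
    finally show "ennreal (\<integral>x. norm (f x) * indicator (D k) x \<partial>M)
        = (\<integral>\<^sup>+ x\<in>D k. ennreal (norm (f x)) \<partial>M)" .
  qed
  also have "\<dots> = (\<integral>\<^sup>+ x\<in>(\<Union>k. D k). ennreal (norm (f x)) \<partial>M)"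
    using D(1,2) by (intro nn_integral_disjoint_family[symmetric]) auto
  also have "\<dots> = (\<integral>\<^sup>+ x. ennreal (norm (f x)) \<partial>M)"
    unfolding D(3) by (intro nn_integral_cong) simp
  also have "\<dots> = ennreal (\<integral>x. norm (f x) \<partial>M)"
    using f by (intro nn_integral_eq_integral) auto
  finally have "(\<lambda>k. ennreal (\<integral>x. norm (f x) * indicator (D k) x \<partial>M))
      sums ennreal (\<integral>x. norm (f x) \<partial>M)"
    by (simp add: sums_iff)
  then show ?thesis by (subst (asm) sums_ennreal) auto
qed

text \<open>The coefficients are the masses of the norm of \<open>f\<close> on disjoint pieces
  covering the space, so they add up to the full L1 norm. As the balls increase and
  \<open>phi0\<close> decreases, every weight is at most the one of \<open>U 0\<close>.\<close>

lemma exhaustion_block_decomp: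
  assumes v: "v > -1" and f: "integrable M f"
    and U: "\<And>n. is_qball M d (U n)" "range U \<subseteq> sets M" "incseq U" "(\<Union>n. U n) = space M"
      "\<And>n. 0 < emeasure M (U n)" "\<And>n. emeasure M (U n) < \<infinity>"
  shows "\<exists>l a. block_decomp v M d f l a U \<and>
    (\<Sum>j. norm (l j) * (1 + phi0 v (measure M (U j))))
      \<le> (\<integral>x. norm (f x) \<partial>M) * (1 + phi0 v (measure M (U 0)))"
proof -
  \<comment> \<open>The pieces are the shells between successive balls; \<open>f\<close> on the
    shell \<open>D k\<close>, normalised, is a block on \<open>U k\<close>.\<close>
  define D where "D = disjointed U"
  define lam where "lam k = (\<integral>x. norm (f x) * indicator (D k) x \<partial>M)" for k
  \<comment> \<open>If \<open>lam k\<close> is 0, division by zero makes \<open>a k\<close> the zero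
    function, which is still a block.\<close>
  define a where "a k x = f x * indicator (D k) x / of_real (lam k)" for k x
  define w where "w k = norm (complex_of_real (lam k)) * (1 + phi0 v (measure M (U k)))" for k
  define K where "K = 1 + phi0 v (measure M (U 0))"
  have [measurable]: "f \<in> borel_measurable M" using f by simp
  have Dsets[measurable]: "D k \<in> sets M" for k
    using sets.range_disjointed_sets[OF U(2)] by (auto simp: D_def)
  have DU: "D k \<subseteq> U k" for k by (simp add: D_def disjointed_subset)
  have disj: "disjoint_family D" by (simp add: D_def disjoint_family_disjointed)
  have UnD: "(\<Union>k. D k) = space M" using U(4) by (simp add: D_def UN_disjointed_eq)
  have int: "integrable M (\<lambda>x. norm (f x) * indicator (D k) x)" for k
    using f by (intro integrable_real_mult_indicator) auto
  have lam0: "lam k \<ge> 0" for k unfolding lam_def by (rule integral_nonneg_AE) simp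
  have lam_sums: "lam sums (\<integral>x. norm (f x) \<partial>M)"
    unfolding lam_def by (rule partition_integral_norm_sums[OF f Dsets disj UnD])
  have blk: "one_block M d (U k) (a k)" for k
  proof -
    have "(\<integral>\<^sup>+ x\<in>U k. ennreal (norm (a k x)) \<partial>M)
        = (\<integral>\<^sup>+ x. ennreal (norm (f x) * indicator (D k) x / lam k) \<partial>M)"
      using DU[of k] lam0[of k]
      by (intro nn_integral_cong) (auto simp: a_def norm_divide norm_mult indicator_def)
    also have "\<dots> = ennreal (\<integral>x. norm (f x) * indicator (D k) x / lam k \<partial>M)"
      using lam0[of k] int[of k] by (intro nn_integral_eq_integral) auto
    also have "\<dots> = ennreal (lam k / lam k)" by (simp add: lam_def)
    also have "\<dots> \<le> 1" by simp
    finally have "(\<integral>\<^sup>+ x\<in>U k. ennreal (norm (a k x)) \<partial>M) \<le> 1" .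
    moreover have "a k \<in> borel_measurable M" unfolding a_def by measurable
    moreover have "\<forall>x\<in>space M - U k. a k x = 0"
      using DU[of k] by (auto simp: a_def indicator_def)
    ultimately show ?thesis using U(1,5,6) by (simp add: one_block_def)
  qed
  have phi_le: "phi0 v (measure M (U k)) \<le> phi0 v (measure M (U 0))" for k
  proof (rule phi0_antimono[OF v])
    show "0 < measure M (U 0)"
      using U(5,6)[of 0] by (simp add: measure_def enn2real_positive_iff)
    have "U k \<in> fmeasurable M" using U(2,6) by (auto simp: fmeasurable_def)
    then show "measure M (U 0) \<le> measure M (U k)"
      using U(2,3) by (intro measure_mono_fmeasurable) (auto simp: incseq_def)
  qed
  have w0: "0 \<le> w k" and wK: "w k \<le> lam k * K" for k
    unfolding w_def K_def using phi_le[of k] phi0_nonneg[OF v] lam0[of k]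
    by (auto intro!: mult_left_mono mult_nonneg_nonneg add_nonneg_nonneg)
  have lamK: "(\<lambda>k. lam k * K) sums ((\<integral>x. norm (f x) \<partial>M) * K)"
    using lam_sums by (rule sums_mult2)
  have sw: "summable w"
    using w0 wK by (intro summable_comparison_test'[OF sums_summable[OF lamK], of 0]) auto
  have "suminf w \<le> (\<integral>x. norm (f x) \<partial>M) * K"
    using suminf_le[OF wK sw sums_summable[OF lamK]] sums_unique[OF lamK] by simp
  \<comment> \<open>When \<open>lam k\<close> is 0, \<open>f\<close> vanishes on \<open>D k\<close>
    only almost everywhere, so the identity may fail on a null set for each of the countably many
    k.\<close>
  moreover have "AE x in M. \<forall>k. of_real (lam k) * a k x = f x * indicator (D k) x"
    unfolding AE_all_countable
  proof
    fix k
    show "AE x in M. of_real (lam k) * a k x = f x * indicator (D k) x"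
    proof (cases "lam k = 0")
      case True
      then have "AE x in M. norm (f x) * indicator (D k) x = 0"
        using int[of k] by (simp add: lam_def integral_nonneg_eq_0_iff_AE)
      then show ?thesis
        by eventually_elim (use True in \<open>auto simp: a_def indicator_def split: if_splits\<close>)
    qed (simp add: a_def)
  qed
  then have "AE x in M. (\<lambda>k. of_real (lam k) * a k x) sums f x"
    using AE_space
  proof eventually_elim
    case (elim x)
    \<comment> \<open>The point lies in exactly one shell, so at most one term of the series is
      nonzero.\<close>
    then obtain i where i: "x \<in> D i" using UnD by blast
    have "x \<notin> D k" if "k \<noteq> i" for k
      using disj i that by (auto simp: disjoint_family_on_def)
    then have "(\<lambda>k. of_real (lam k) * a k x) = (\<lambda>k. if k = i then f x else 0)"
      using elim i by (auto simp: indicator_def)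
    then show ?case using sums_single[of i "\<lambda>_. f x"] by simp
  qed
  ultimately have "block_decomp v M d f (\<lambda>k. of_real (lam k)) a U"
    and "suminf w \<le> (\<integral>x. norm (f x) \<partial>M) * K"
    using blk sw by (simp_all add: block_decomp_def w_def[abs_def])
  then show ?thesis unfolding w_def K_def by blast
qed

section \<open>Exhaustion by concentric balls\<close>

lemma ball_exhaustion:
  assumes "ahlfors_regular s M d"
    and "\<And>x r. x \<in> space M \<Longrightarrow> r > 0 \<Longrightarrow> emeasure M (qball (space M) d x r) < \<infinity>"
  obtains U where "\<And>n. is_qball M d (U n)" "range U \<subseteq> sets M" "incseq U" "(\<Union>n. U n) = space M"
    "\<And>n. 0 < emeasure M (U n)" "\<And>n. emeasure M (U n) < \<infinity>"
proof -
  have nz: "emeasure M (space M) \<noteq> 0"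
    and meas: "\<And>x r. x \<in> space M \<Longrightarrow> r > 0 \<Longrightarrow> qball (space M) d x r \<in> sets M"
    using assms(1) by (auto simp: ahlfors_regular_def)
  have "space M \<noteq> {}" using nz by force
  then obtain x where x: "x \<in> space M" by blast
  \<comment> \<open>\<open>Suc\<close> keeps every radius positive, as \<open>is_qball\<close>
    demands.\<close>
  define V where "V n = qball (space M) d x (real (Suc n))" for n
  have V_sets: "V n \<in> sets M" for n unfolding V_def by (intro meas x) simp
  have V_inc: "V m \<subseteq> V n" if "m \<le> n" for m n
    using that by (auto simp: V_def qball_def)
  have V_Un: "(\<Union>n. V n) = space M"
  proof
    show "space M \<subseteq> (\<Union>n. V n)"
    proof
      fix y assume y: "y \<in> space M"
      obtain n :: nat where "d x y < real n" using reals_Archimedean2 by blast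
      with y have "y \<in> V n" by (auto simp: V_def qball_def)
      then show "y \<in> (\<Union>n. V n)" by blast
    qed
  qed (auto simp: V_def qball_def)
  have lim: "(\<lambda>n. emeasure M (V n)) \<longlonglongrightarrow> emeasure M (space M)"
    using Lim_emeasure_incseq[of V M] V_sets V_inc V_Un by (auto simp: incseq_def)
  \<comment> \<open>Blocks live on balls of positive measure. Continuity from below yields one
    because the space is not null, and the sequence is restarted there.\<close>
  obtain N where N: "0 < emeasure M (V N)"
    using order_tendstoD(1)[OF lim, of 0] nz
    by (auto simp: zero_less_iff_neq_zero eventually_sequentially)
  have tail: "(\<Union>n. V (n + N)) = space M"
    using V_Un V_inc[OF le_add1] by blast
  show ?thesis
  proof (rule that[of "\<lambda>n. V (n + N)"])
    show "is_qball M d (V (n + N))" for n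
      unfolding is_qball_def V_def using x by (intro bexI[of _ x] exI[of _ "real (Suc (n + N))"]) auto
    show "range (\<lambda>n. V (n + N)) \<subseteq> sets M" using V_sets by auto
    show "incseq (\<lambda>n. V (n + N))" by (auto simp: incseq_def intro!: V_inc)
    show "(\<Union>n. V (n + N)) = space M" by (rule tail)
    show "0 < emeasure M (V (n + N))" for n
      using N emeasure_mono[OF V_inc[of N "n + N"] V_sets] by (simp add: order_less_le_trans)
    \<comment> \<open>The regularity bounds speak only of radii below the diameter; for larger radii
      finiteness comes from the separate hypothesis on balls.\<close>
    show "emeasure M (V (n + N)) < \<infinity>" for n
      unfolding V_def by (intro assms(2) x) simp
  qed
qed

section \<open>The equality of spaces and the two norm inequalities\<close>

theorem theorem1p11:
  fixes M :: "'a measure" and d :: "'a \<Rightarrow> 'a \<Rightarrow> real" and s v :: real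
  assumes "ahlfors_regular s M d"
    and balls_finite: "\<And>x r. x \<in> space M \<Longrightarrow> r > 0 \<Longrightarrow> emeasure M (qball (space M) d x r) < \<infinity>"
    and "v > -1"
  shows "block_space v M d = {f :: 'a \<Rightarrow> complex. integrable M f} \<and>
    (\<forall>f\<in>block_space v M d.
       (\<integral>x. norm (f x) \<partial>M) \<le> block_norm v M d f \<and>
       block_norm v M d f \<le> (\<integral>x. norm (f x) \<partial>M) *
         (1 + 1 / (1 + v) * log_plus_inv (emeasure M (space M)) powr (1 + v)))"
proof -
  obtain U where U: "\<And>n. is_qball M d (U n)" "range U \<subseteq> sets M" "incseq U" "(\<Union>n. U n) = space M"
    "\<And>n. 0 < emeasure M (U n)" "\<And>n. emeasure M (U n) < \<infinity>"
    using ball_exhaustion[OF assms(1) balls_finite] by blast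
  define S where "S f = {(\<Sum>j. norm (l j) * (1 + phi0 v (measure M (B j)))) | l a B.
    block_decomp v M d f l a B}" for f
  \<comment> \<open>Dropping the first n balls makes \<open>U n\<close> the starting ball, so its
    weight controls the cost.\<close>
  have dec: "\<exists>l a. block_decomp v M d f l a (\<lambda>k. U (k + n)) \<and>
      (\<Sum>j. norm (l j) * (1 + phi0 v (measure M (U (j + n)))))
        \<le> (\<integral>x. norm (f x) \<partial>M) * (1 + phi0 v (measure M (U n)))"
    if f: "integrable M f" for f n
  proof -
    have "(\<Union>k. U (k + n)) = space M"
      using U(4) incseqD[OF U(3) le_add1] by blast
    then show ?thesis
      using exhaustion_block_decomp[OF \<open>v > -1\<close> f, of d "\<lambda>k. U (k + n)"] U
      by (simp add: incseq_def image_subset_iff)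
  qed
  have lower: "(\<integral>x. norm (f x) \<partial>M) \<le> y" if "integrable M f" "y \<in> S f" for f y
    using that integral_norm_le_block_sum[OF \<open>v > -1\<close>] by (auto simp: S_def)
  have ex: "\<exists>y\<in>S f. y \<le> (\<integral>x. norm (f x) \<partial>M) * (1 + phi0 v (measure M (U n)))"
    if f: "integrable M f" for f n
  proof -
    obtain l a where "block_decomp v M d f l a (\<lambda>k. U (k + n))"
      and le: "(\<Sum>j. norm (l j) * (1 + phi0 v (measure M (U (j + n)))))
        \<le> (\<integral>x. norm (f x) \<partial>M) * (1 + phi0 v (measure M (U n)))"
      using dec[OF f] by blast
    then have "(\<Sum>j. norm (l j) * (1 + phi0 v (measure M (U (j + n))))) \<in> S f"
      unfolding S_def mem_Collect_eq
      by (intro exI[of _ l] exI[of _ a] exI[of _ "\<lambda>k. U (k + n)"]) simp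
    with le show ?thesis by blast
  qed
  have space_eq: "block_space v M d = {f. integrable M f}"
    unfolding block_space_def using dec by blast
  moreover have "(\<integral>x. norm (f x) \<partial>M) \<le> block_norm v M d f \<and>
      block_norm v M d f \<le> (\<integral>x. norm (f x) \<partial>M) *
        (1 + 1 / (1 + v) * log_plus_inv (emeasure M (space M)) powr (1 + v))"
    if f: "integrable M f" for f
  proof
    have norm_eq: "block_norm v M d f = Inf (S f)" by (simp add: block_norm_def S_def)
    \<comment> \<open>A real \<open>Inf\<close> is meaningful only for a nonempty set that is
      bounded below: \<open>lower\<close> gives the bound and \<open>ex\<close> a member.\<close>
    have bdd: "bdd_below (S f)" using lower[OF f] by (auto simp: bdd_below_def)
    show "(\<integral>x. norm (f x) \<partial>M) \<le> block_norm v M d f"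
      unfolding norm_eq using ex[OF f] lower[OF f] by (intro cInf_greatest) auto
    \<comment> \<open>The left side does not depend on n, so n can tend to infinity on the right; no
      single decomposition has to attain the limiting cost.\<close>
    have upper: "block_norm v M d f \<le> (\<integral>x. norm (f x) \<partial>M) * (1 + phi0 v (measure M (U n)))" for n
      unfolding norm_eq using ex[OF f, of n] cInf_lower[OF _ bdd] by (meson order_trans)
    have "emeasure M (space M) \<noteq> 0" using assms(1) by (simp add: ahlfors_regular_def)
    then show "block_norm v M d f \<le> (\<integral>x. norm (f x) \<partial>M) *
        (1 + 1 / (1 + v) * log_plus_inv (emeasure M (space M)) powr (1 + v))"
      using upper
      by (intro LIMSEQ_le_const[OF tendsto_mult_left[OF tendsto_add[OF tendsto_const
            phi0_measure_space_tendsto[OF \<open>v > -1\<close> _ U(2-4,6)]]]]) auto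
  qed
  ultimately show ?thesis by auto
qed

end
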